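(* Let $k, m$ be integers with $0 < k \leq m < \infty$, let $0 < \theta \leq 1$, and let $T_k \sim \text{NegOcc}(m,k,\theta)$ with cumulant generating function $K(s) = \ln \mathbb{E}(e^{sT_k})$. Then, for all $s$ in some open neighbourhood of $0$, the following series converges and $$K(s) = -ks + \sum_{n=1}^{\infty} \frac{(1-e^{-s})^n}{n}\cdot h_n(m,k,\theta).$$ Consequently, for each integer $r \geq 1$, the $r$th cumulant of the negative occupancy distribution is $$\kappa_r = \sum_{i=1}^{r} (-1)^{r-i}\cdot S(r,i)\cdot (i-1)!\cdot h_i(m,k,\theta) - k\cdot\mathbb{I}(r=1).$$
   Context: Falling factorials: $(m)_k = \prod_{i=0}^{k-1}(m-i)$. The noncentral Stirling numbers of the second kind are, for integers $n, k \geq 0$ and real $\phi$, $$S(n,k,\phi) = \frac{1}{k!}\sum_{i=0}^{k} \binom{k}{i} (-1)^{k-i} (i+\phi)^n, \qquad 0^0 = 1,$$ and $S(r,i) = S(r,i,0)$ are the ordinary Stirling numbers of the second kind. The negative occupancy distribution $\text{NegOcc}(m,k,\theta)$ is the distribution on the integers $t \geq 0$ with probability mass function $$\text{NegOcc}(t|m,k,\theta) = \frac{\theta^{k+t}}{m^{k+t}} \cdot (m)_k \cdot S\left(k+t-1, k-1, m\cdot\frac{1-\theta}{\theta}\right).$$ The generalised harmonic numbers are $H_m^{(r)} = \sum_{\ell=1}^{m} \ell^{-r}$ (with $H_0^{(r)} = 0$), and $$h_i(m,k,\theta) = \left(\frac{m}{\theta}\right)^i \left(H_m^{(i)} - H_{m-k}^{(i)}\right).$$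 The $r$th cumulant is $\kappa_r = K^{(r)}(0)$, and $\mathbb{I}$ is the indicator function. *)

theory Defs
  imports "HOL-Probability.Probability"
begin

definition falling :: "real \<Rightarrow> nat \<Rightarrow> real" where
  "falling x k = (\<Prod>i<k. x - real i)"

definition ncStirling :: "nat \<Rightarrow> nat \<Rightarrow> real \<Rightarrow> real" where
  "ncStirling n k \<phi> =
     1 / fact k * (\<Sum>i\<le>k. real (k choose i) * (-1) ^ (k - i) * (real i + \<phi>) ^ n)"

definition negocc_mass :: "nat \<Rightarrow> nat \<Rightarrow> real \<Rightarrow> nat \<Rightarrow> real" where
  "negocc_mass m k \<theta> t =
     \<theta> ^ (k + t) / real m ^ (k + t) * falling (real m) k *
       ncStirling (k + t - 1) (k - 1) (real m * ((1 - \<theta>) / \<theta>))"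

text \<open>Meaningful for \<open>0 < k \<le> m\<close> and \<open>0 < \<theta> \<le> 1\<close>; that the mass function really is a
  probability mass function in this range is proved as \<open>pmf_negocc\<close> below.\<close>

definition negocc_pmf :: "nat \<Rightarrow> nat \<Rightarrow> real \<Rightarrow> nat pmf" where
  "negocc_pmf m k \<theta> = embed_pmf (negocc_mass m k \<theta>)"

definition gen_harm :: "nat \<Rightarrow> nat \<Rightarrow> real" where
  "gen_harm m r = (\<Sum>l=1..m. 1 / real l ^ r)"

definition h_harm :: "nat \<Rightarrow> nat \<Rightarrow> nat \<Rightarrow> real \<Rightarrow> real" where
  "h_harm i m k \<theta> = (real m / \<theta>) ^ i * (gen_harm m i - gen_harm (m - k) i)"

text \<open>Both functions below are total; they carry their intended meaning where the exponential
  moments are finite and where the iterated derivatives exist, respectively.\<close>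

definition cgf :: "'a measure \<Rightarrow> ('a \<Rightarrow> real) \<Rightarrow> real \<Rightarrow> real" where
  "cgf M X s = ln (\<integral>x. exp (s * X x) \<partial>M)"

definition cumulant :: "'a measure \<Rightarrow> ('a \<Rightarrow> real) \<Rightarrow> nat \<Rightarrow> real" where
  "cumulant M X r = (deriv ^^ r) (cgf M X) 0"

lemma ncStirling_0_right: "ncStirling n 0 \<phi> = \<phi> ^ n"
  by (simp add: ncStirling_def)

lemma ncStirling_0_Suc: "ncStirling 0 (Suc k) \<phi> = 0"
proof -
  have "(\<Sum>i\<le>Suc k. real (Suc k choose i) * (-1) ^ (Suc k - i)) = (1 + (-1)) ^ Suc k"
    by (subst binomial_ring) simp
  then show ?thesis
    by (simp add: ncStirling_def)
qed

lemma ncStirling_Suc_Suc: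
  "ncStirling (Suc n) (Suc k) \<phi> =
     (real (Suc k) + \<phi>) * ncStirling n (Suc k) \<phi> + ncStirling n k \<phi>"
proof -
  define c where "c i = real (Suc k choose i) * (-1) ^ (Suc k - i)" for i
  define d where "d i = real (k choose i) * (-1) ^ (k - i)" for i
  have cd: "c i * (real (Suc k) - real i) = - real (Suc k) * d i" if "i \<le> k" for i
  proof -
    have "real ((Suc k - i) * (Suc k choose i)) = real (Suc k * (k choose i))"
      using binomial_absorb_comp[of "Suc k" i] by simp
    then have *: "(real (Suc k) - real i) * real (Suc k choose i) = real (Suc k) * real (k choose i)"
      using that by (simp only: of_nat_mult of_nat_diff le_SucI)
    have "c i * (real (Suc k) - real i)
        = - ((-1) ^ (k - i)) * ((real (Suc k) - real i) * real (Suc k choose i))"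
      using that by (simp add: c_def Suc_diff_le)
    then show ?thesis
      unfolding * by (simp add: d_def algebra_simps)
  qed
  have "(\<Sum>i\<le>Suc k. c i * (real i + \<phi>) ^ Suc n)
      = (\<Sum>i\<le>Suc k. (real (Suc k) + \<phi>) * (c i * (real i + \<phi>) ^ n)
           - c i * (real (Suc k) - real i) * (real i + \<phi>) ^ n)"
    by (intro sum.cong) (auto simp: algebra_simps)
  also have "\<dots> = (real (Suc k) + \<phi>) * (\<Sum>i\<le>Suc k. c i * (real i + \<phi>) ^ n)
      - (\<Sum>i\<le>k. c i * (real (Suc k) - real i) * (real i + \<phi>) ^ n)"
    by (simp add: sum_subtractf sum_distrib_left distrib_left)
  also have "(\<Sum>i\<le>k. c i * (real (Suc k) - real i) * (real i + \<phi>) ^ n)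
      = (\<Sum>i\<le>k. - real (Suc k) * (d i * (real i + \<phi>) ^ n))"
    by (intro sum.cong refl) (simp only: cd atMost_iff mult.assoc)
  also have "\<dots> = - real (Suc k) * (\<Sum>i\<le>k. d i * (real i + \<phi>) ^ n)"
    by (simp only: sum_distrib_left)
  finally have *: "(\<Sum>i\<le>Suc k. c i * (real i + \<phi>) ^ Suc n) =
      (real (Suc k) + \<phi>) * (\<Sum>i\<le>Suc k. c i * (real i + \<phi>) ^ n)
      + real (Suc k) * (\<Sum>i\<le>k. d i * (real i + \<phi>) ^ n)"
    by (simp only: mult_minus_left diff_minus_eq_add)
  have "ncStirling (Suc n) (Suc k) \<phi> = 1 / fact (Suc k) *
      ((real (Suc k) + \<phi>) * (\<Sum>i\<le>Suc k. c i * (real i + \<phi>) ^ n)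
      + real (Suc k) * (\<Sum>i\<le>k. d i * (real i + \<phi>) ^ n))"
    unfolding *[symmetric] by (simp only: ncStirling_def c_def)
  also have "\<dots> = (real (Suc k) + \<phi>) * (1 / fact (Suc k) * (\<Sum>i\<le>Suc k. c i * (real i + \<phi>) ^ n))
      + 1 / fact k * (\<Sum>i\<le>k. d i * (real i + \<phi>) ^ n)"
  proof -
    have aux: "u * (a * X + b * Y) = a * (u * X) + u * b * Y" for u a b X Y :: real
      by (simp add: algebra_simps)
    have "1 / fact (Suc k) * real (Suc k) = (1 / fact k :: real)"
      by (simp add: fact_Suc del: of_nat_Suc)
    then show ?thesis
      by (simp only: aux)
  qed
  finally show ?thesis
    by (simp only: ncStirling_def c_def d_def)
qed

lemma ncStirling_eq_0: "n < k \<Longrightarrow> ncStirling n k \<phi> = 0"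
proof (induction n arbitrary: k)
  case 0
  then show ?case by (cases k) (simp_all add: ncStirling_0_Suc)
next
  case (Suc n)
  then show ?case by (cases k) (simp_all add: ncStirling_Suc_Suc)
qed

lemma ncStirling_nonneg: "0 \<le> \<phi> \<Longrightarrow> 0 \<le> ncStirling n k \<phi>"
proof (induction n arbitrary: k)
  case 0
  then show ?case by (cases k) (simp_all add: ncStirling_0_Suc ncStirling_0_right)
next
  case (Suc n)
  then show ?case
    by (cases k) (simp_all add: ncStirling_Suc_Suc ncStirling_0_right del: of_nat_Suc)
qed

lemma negocc_mass_nonneg:
  assumes "k \<le> m" "0 < \<theta>" "\<theta> \<le> 1"
  shows "0 \<le> negocc_mass m k \<theta> t"
  using assms unfolding negocc_mass_def falling_def
  by (intro mult_nonneg_nonneg prod_nonneg ncStirling_nonneg) auto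

text \<open>The \<open>k\<close>-th geometric waiting time has success probability \<open>\<theta> (m - k) / m\<close> (counting from 0).\<close>

lemma negocc_mass_1:
  assumes "0 < m" "0 < \<theta>"
  shows "negocc_mass m (Suc 0) \<theta> t = \<theta> * (1 - \<theta>) ^ t"
  using assms by (simp add: negocc_mass_def falling_def ncStirling_0_right power_mult_distrib power_divide)

lemma negocc_mass_Suc_0:
  assumes "0 < k"
  shows "negocc_mass m (Suc k) \<theta> 0 = \<theta> * (real m - real k) / real m * negocc_mass m k \<theta> 0"
proof -
  obtain j where j: "k = Suc j" using assms by (cases k) auto
  show ?thesis
    unfolding j by (simp add: negocc_mass_def falling_def ncStirling_Suc_Suc ncStirling_eq_0)
qed

lemma negocc_mass_Suc_Suc:
  assumes "0 < k" "0 < m" "0 < \<theta>"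
  shows "negocc_mass m (Suc k) \<theta> (Suc t) =
    (1 - \<theta> * (real m - real k) / real m) * negocc_mass m (Suc k) \<theta> t
     + \<theta> * (real m - real k) / real m * negocc_mass m k \<theta> (Suc t)"
proof -
  obtain j where j: "k = Suc j" using assms by (cases k) auto
  define \<phi> where "\<phi> = real m * ((1 - \<theta>) / \<theta>)"
  have \<phi>: "1 - \<theta> / real m * (real m - real k) = \<theta> / real m * (real k + \<phi>)"
    using assms by (simp add: \<phi>_def field_simps)
  have S: "ncStirling (k + Suc t) k \<phi> =
      (real k + \<phi>) * ncStirling (k + t) k \<phi> + ncStirling (k + t) (k - 1) \<phi>"
    unfolding j using ncStirling_Suc_Suc[of "Suc j + t" j \<phi>] by simp
  define P where "P = \<theta> ^ (k + t) / real m ^ (k + t) * falling (real m) k"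
  define x where "x = ncStirling (k + t) k \<phi>"
  define y where "y = ncStirling (k + t) (k - 1) \<phi>"
  have 1: "negocc_mass m (Suc k) \<theta> (Suc t) =
      (\<theta> / real m) * (\<theta> / real m) * P * (real m - real k) * ((real k + \<phi>) * x + y)"
    unfolding negocc_mass_def \<phi>_def[symmetric] using S
    by (simp add: P_def x_def y_def falling_def mult_ac)
  have 2: "negocc_mass m (Suc k) \<theta> t = (\<theta> / real m) * P * (real m - real k) * x"
    unfolding negocc_mass_def \<phi>_def[symmetric] by (simp add: P_def x_def falling_def)
  have 3: "negocc_mass m k \<theta> (Suc t) = (\<theta> / real m) * P * y"
    unfolding negocc_mass_def \<phi>_def[symmetric] by (simp add: P_def y_def)
  have c: "\<theta> * (real m - real k) / real m = \<theta> / real m * (real m - real k)"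
    by simp
  show ?thesis
    unfolding \<phi> 1 2 3 c by (simp add: algebra_simps del: times_divide_eq_left times_divide_eq_right)
qed

lemma negocc_mass_Suc:
  assumes "0 < k" "0 < m" "0 < \<theta>"
  defines "q \<equiv> \<theta> * (real m - real k) / real m"
  shows "negocc_mass m (Suc k) \<theta> t = (\<Sum>i\<le>t. negocc_mass m k \<theta> i * (q * (1 - q) ^ (t - i)))"
proof (induction t)
  case 0
  then show ?case
    using negocc_mass_Suc_0[OF assms(1), of m \<theta>] by (simp add: q_def)
next
  case (Suc t)
  have "(\<Sum>i\<le>t. negocc_mass m k \<theta> i * (q * (1 - q) ^ (Suc t - i)))
      = (1 - q) * (\<Sum>i\<le>t. negocc_mass m k \<theta> i * (q * (1 - q) ^ (t - i)))"
    by (auto simp: sum_distrib_left Suc_diff_le mult_ac intro!: sum.cong)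
  moreover have "negocc_mass m (Suc k) \<theta> (Suc t) =
      (1 - q) * negocc_mass m (Suc k) \<theta> t + q * negocc_mass m k \<theta> (Suc t)"
    using negocc_mass_Suc_Suc[OF assms(1-3), of t] by (simp only: q_def)
  ultimately show ?case
    by (simp add: Suc.IH)
qed

lemma sums_geometric:
  fixes q :: real
  assumes "0 < q" "q \<le> 1"
  shows "(\<lambda>t. q * (1 - q) ^ t) sums 1"
  using sums_mult[OF geometric_sums[of "1 - q"], of q] assms by simp

lemma negocc_mass_sums:
  assumes "0 < k" "k \<le> m" "0 < \<theta>" "\<theta> \<le> 1"
  shows "negocc_mass m k \<theta> sums 1"
  using assms
proof (induction k)
  case 0
  then show ?case by simp
next
  case (Suc k)
  show ?case
  proof (cases "k = 0")
    case True
    then show ?thesis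
      using Suc.prems sums_geometric[of \<theta>] negocc_mass_1[of m \<theta>] by simp
  next
    case False
    define q where "q = \<theta> * (real m - real k) / real m"
    have "\<theta> * (real m - real k) \<le> 1 * real m"
      using Suc.prems by (intro mult_mono) auto
    then have q: "0 < q" "q \<le> 1"
      using Suc.prems by (auto simp: q_def)
    have k: "negocc_mass m k \<theta> sums 1"
      using Suc False by simp
    have "(\<lambda>t. \<Sum>i\<le>t. negocc_mass m k \<theta> i * (q * (1 - q) ^ (t - i))) sums (1 * 1)"
      using Cauchy_product_sums[of "negocc_mass m k \<theta>" "\<lambda>t. q * (1 - q) ^ t"]
        k sums_geometric[OF q] negocc_mass_nonneg[of k m \<theta>] Suc.prems q
      by (simp add: sums_iff)
    then show ?thesis
      using negocc_mass_Suc[of k m \<theta>] False Suc.prems by (simp add: q_def)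
  qed
qed

lemma pmf_negocc:
  assumes "0 < k" "k \<le> m" "0 < \<theta>" "\<theta> \<le> 1"
  shows "pmf (negocc_pmf m k \<theta>) t = negocc_mass m k \<theta> t"
  unfolding negocc_pmf_def
proof (rule pmf_embed_pmf)
  show "0 \<le> negocc_mass m k \<theta> t" for t
    using negocc_mass_nonneg assms by simp
  then show "(\<integral>\<^sup>+t. ennreal (negocc_mass m k \<theta> t) \<partial>count_space UNIV) = 1"
    using negocc_mass_sums[OF assms]
    by (simp add: nn_integral_count_space_nat suminf_ennreal_eq sums_unique[symmetric])
qed

end

theory Submission
  imports Defs
begin

text \<open>
  The mass function is a convolution of geometric laws with success probabilities
  \<open>q\<^sub>j = \<theta> (m - j) / m\<close> for \<open>j < k\<close>, so with \<open>a\<^sub>j = 1 / q\<^sub>j\<close> and \<open>u = 1 - e\<^sup>-\<^sup>s\<close> the moment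
  generating function is the product of the factors \<open>e\<^sup>-\<^sup>s / (1 - a\<^sub>j u)\<close>. Taking logarithms and
  expanding in powers of \<open>u\<close> gives the series, because \<open>h\<^sub>n\<close> is the power sum of the \<open>a\<^sub>j\<close>.
  The function \<open>x\<^sub>j = a\<^sub>j e\<^sup>-\<^sup>s / (1 - a\<^sub>j u)\<close> is the derivative of \<open>-ln (1 - a\<^sub>j u)\<close> and satisfies
  \<open>x' = x\<^sup>2 - x\<close>. Under this equation differentiation acts on polynomials in \<open>x\<close> by the
  recurrence of the Stirling numbers, and \<open>x\<^sub>j(0) = a\<^sub>j\<close>.
\<close>

section \<open>Iterated derivatives and Stirling polynomials\<close>

text \<open>The value of \<open>deriv\<close> at a point depends on the function nearby, so the
  induction carries equality on all of the open set \<open>U\<close>. The second conclusion is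
  separate because \<open>deriv\<close> is total and its value alone does not witness
  differentiability.\<close>

lemma deriv_funpow_on_open:
  fixes f :: "real \<Rightarrow> real" and D :: "nat \<Rightarrow> real \<Rightarrow> real"
  assumes U: "open U"
    and D0: "\<And>s. s \<in> U \<Longrightarrow> f s = D 0 s"
    and D: "\<And>r s. s \<in> U \<Longrightarrow> (D r has_real_derivative D (Suc r) s) (at s)"
    and s: "s \<in> U"
  shows "(deriv ^^ r) f s = D r s"
    and "((deriv ^^ r) f has_real_derivative D (Suc r) s) (at s)"
proof -
  have *: "((deriv ^^ r) f has_real_derivative D (Suc r) s) (at s)"
    if "s \<in> U" "\<And>t. t \<in> U \<Longrightarrow> (deriv ^^ r) f t = D r t" for r s
    by (rule has_field_derivative_transform_within_open[OF D[OF that(1)] U that(1)])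
      (simp add: that(2))
  have eq: "\<forall>t\<in>U. (deriv ^^ r) f t = D r t" for r
  proof (induction r)
    case 0
    then show ?case using D0 by simp
  next
    case (Suc r)
    then show ?case using * by (auto intro!: DERIV_imp_deriv)
  qed
  show "(deriv ^^ r) f s = D r s"
    using eq s by blast
  show "((deriv ^^ r) f has_real_derivative D (Suc r) s) (at s)"
    using * eq s by blast
qed

text \<open>For positive \<open>r\<close> and \<open>x = 1 / q\<close> this is the
  \<open>r\<close>-th cumulant of the geometric law on the positive integers with success
  probability \<open>q\<close>.\<close>

definition stirling_poly :: "nat \<Rightarrow> real \<Rightarrow> real" where
  "stirling_poly r x = (\<Sum>i=1..r. (-1) ^ (r - i) * ncStirling r i 0 * fact (i - 1) * x ^ i)"

lemma stirling_poly_1 [simp]: "stirling_poly (Suc 0) x = x"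
  by (simp add: stirling_poly_def ncStirling_Suc_Suc ncStirling_0_right ncStirling_eq_0)

text \<open>The exponents \<open>r - Suc j\<close> and \<open>r + Suc j\<close> have the same
  parity; the second avoids truncated subtraction, so that the Stirling recurrence can be applied
  termwise.\<close>

lemma stirling_poly_altdef:
  "stirling_poly r x = (\<Sum>j<r. (-1) ^ (r + Suc j) * ncStirling r (Suc j) 0 * fact j * x ^ Suc j)"
proof -
  have "stirling_poly r x =
      (\<Sum>j<r. (-1) ^ (r - Suc j) * ncStirling r (Suc j) 0 * fact j * x ^ Suc j)"
    unfolding stirling_poly_def
    by (rule sum.reindex_bij_witness[of _ Suc "\<lambda>i. i - 1"]) auto
  also have "\<dots> = (\<Sum>j<r. (-1) ^ (r + Suc j) * ncStirling r (Suc j) 0 * fact j * x ^ Suc j)"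
  proof (rule sum.cong)
    fix j assume "j \<in> {..<r}"
    then have "(-1) ^ (r - Suc j) = ((-1) ^ (r + Suc j) :: real)"
      by (simp add: minus_one_power_iff)
    then show "(-1) ^ (r - Suc j) * ncStirling r (Suc j) 0 * fact j * x ^ Suc j =
        (-1) ^ (r + Suc j) * ncStirling r (Suc j) 0 * fact j * x ^ Suc j"
      by simp
  qed simp
  finally show ?thesis .
qed

text \<open>By the chain rule \<open>g ^ j\<close> becomes
  \<open>j * g ^ (j + 1) - j * g ^ j\<close>. With the weights \<open>fact (j - 1)\<close> and
  alternating signs, this is the recurrence \<open>S(r+1,j) = j S(r,j) + S(r,j-1)\<close> read on
  coefficients.\<close>

lemma stirling_poly_has_derivative:
  assumes r: "0 < r"
    and g: "(g has_real_derivative (g s)\<^sup>2 - g s) (at s)"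
  shows "((\<lambda>s. stirling_poly r (g s)) has_real_derivative stirling_poly (Suc r) (g s)) (at s)"
proof -
  define x where "x = g s"
  define c where "c j = (-1) ^ (r + j) * ncStirling r j 0" for j
  \<comment> \<open>These two boundary coefficients let both sums below be cut down to
    \<open>j < r\<close>; the first vanishes only because \<open>r\<close> is positive.\<close>
  have c0: "c 0 = 0" and cr: "c (Suc r) = 0"
    using r by (simp_all add: c_def ncStirling_0_right ncStirling_eq_0)
  have "stirling_poly (Suc r) x =
      (\<Sum>j<Suc r. c j * fact j * x ^ Suc j - c (Suc j) * fact (Suc j) * x ^ Suc j)"
    unfolding stirling_poly_altdef c_def
    by (intro sum.cong refl) (simp add: ncStirling_Suc_Suc algebra_simps)
  also have "\<dots> = (\<Sum>j<Suc r. c j * fact j * x ^ Suc j)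
      - (\<Sum>j<Suc r. c (Suc j) * fact (Suc j) * x ^ Suc j)"
    by (rule sum_subtractf)
  also have "(\<Sum>j<Suc r. c j * fact j * x ^ Suc j) = (\<Sum>j<r. c (Suc j) * fact (Suc j) * x ^ Suc (Suc j))"
    by (subst sum.lessThan_Suc_shift) (simp add: c0)
  also have "(\<Sum>j<Suc r. c (Suc j) * fact (Suc j) * x ^ Suc j) = (\<Sum>j<r. c (Suc j) * fact (Suc j) * x ^ Suc j)"
    by (simp add: cr)
  also have "(\<Sum>j<r. c (Suc j) * fact (Suc j) * x ^ Suc (Suc j)) - (\<Sum>j<r. c (Suc j) * fact (Suc j) * x ^ Suc j)
      = (\<Sum>j<r. c (Suc j) * fact j * (real (Suc j) * x ^ j * (x\<^sup>2 - x)))"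
    unfolding sum_subtractf[symmetric]
    by (intro sum.cong refl) (simp add: algebra_simps power2_eq_square)
  finally have eq: "stirling_poly (Suc r) x =
      (\<Sum>j<r. c (Suc j) * fact j * (real (Suc j) * x ^ j * (x\<^sup>2 - x)))" .
  have "((\<lambda>s. \<Sum>j<r. c (Suc j) * fact j * g s ^ Suc j) has_real_derivative
      (\<Sum>j<r. c (Suc j) * fact j * (real (Suc j) * x ^ j * (x\<^sup>2 - x)))) (at s)"
    unfolding x_def
    by (intro DERIV_sum DERIV_cmult) (use DERIV_power[OF g, of "Suc _"] in \<open>simp add: mult_ac del: power_Suc\<close>)
  then show ?thesis
    unfolding eq[unfolded x_def] stirling_poly_altdef[of r] c_def by (simp add: x_def)
qed

section \<open>Generating functions of the negative occupancy distribution\<close>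

text \<open>Each step of the induction is a Cauchy product with one geometric series, by
  \<open>negocc_mass_Suc\<close>. The range of \<open>z\<close> extends beyond 1, which is what
  exponential moments with positive \<open>s\<close> require.\<close>

lemma negocc_mass_pgf:
  fixes z :: real
  assumes "0 < k" "k \<le> m" "0 < \<theta>" "\<theta> \<le> 1" "0 \<le> z"
  defines "q \<equiv> \<lambda>j. \<theta> * (real m - real j) / real m"
  assumes "\<And>j. j < k \<Longrightarrow> (1 - q j) * z < 1"
  shows "(\<lambda>t. negocc_mass m k \<theta> t * z ^ t) sums (\<Prod>j<k. q j / (1 - (1 - q j) * z))"
  using assms(1,2,7)
proof (induction k)
  case 0
  then show ?case by simp
next
  case (Suc k)
  have "\<theta> * (real m - real k) \<le> 1 * real m"
    using Suc.prems assms(3,4) by (intro mult_mono) auto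
  then have q: "0 < q k" "q k \<le> 1"
    using Suc.prems assms(3) by (auto simp: q_def)
  have z: "\<bar>(1 - q k) * z\<bar> < 1"
    using Suc.prems(3)[of k] q \<open>0 \<le> z\<close> by (simp add: abs_mult)
  have geo: "(\<lambda>t. q k * ((1 - q k) * z) ^ t) sums (q k / (1 - (1 - q k) * z))"
    using sums_mult[OF geometric_sums[of "(1 - q k) * z"], of "q k"] z by simp
  show ?case
  \<comment> \<open>The convolution recurrence starts at one factor, so the law for
    \<open>Suc 0\<close> is computed directly.\<close>
  proof (cases "k = 0")
    case True
    have "q 0 = \<theta>"
      using Suc.prems(2) by (simp add: q_def)
    then show ?thesis
      using True geo negocc_mass_1[of m \<theta>] Suc.prems assms(3)
      by (simp add: power_mult_distrib mult.assoc)
  next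
    case False
    have IH: "(\<lambda>t. negocc_mass m k \<theta> t * z ^ t) sums (\<Prod>j<k. q j / (1 - (1 - q j) * z))"
      using Suc False by simp
    have "(\<lambda>t. \<Sum>i\<le>t. (negocc_mass m k \<theta> i * z ^ i) * (q k * ((1 - q k) * z) ^ (t - i)))
        sums ((\<Prod>j<k. q j / (1 - (1 - q j) * z)) * (q k / (1 - (1 - q k) * z)))"
      using Cauchy_product_sums[of "\<lambda>t. negocc_mass m k \<theta> t * z ^ t" "\<lambda>t. q k * ((1 - q k) * z) ^ t"]
        IH geo negocc_mass_nonneg[of k m \<theta>] Suc.prems q assms(3-5)
      by (simp add: sums_iff abs_mult)
    moreover have "(\<Sum>i\<le>t. (negocc_mass m k \<theta> i * z ^ i) * (q k * ((1 - q k) * z) ^ (t - i)))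
        = negocc_mass m (Suc k) \<theta> t * z ^ t" for t
    proof -
      have eq: "(negocc_mass m k \<theta> i * z ^ i) * (q k * ((1 - q k) * z) ^ (t - i))
          = negocc_mass m k \<theta> i * (q k * (1 - q k) ^ (t - i)) * z ^ t" if "i \<le> t" for i
      proof -
        have "z ^ t = z ^ i * z ^ (t - i)"
          using that by (simp flip: power_add)
        then show ?thesis
          by (simp add: power_mult_distrib)
      qed
      have mass: "negocc_mass m (Suc k) \<theta> t =
          (\<Sum>i\<le>t. negocc_mass m k \<theta> i * (q k * (1 - q k) ^ (t - i)))"
        unfolding q_def using False Suc.prems(2) assms(3) by (intro negocc_mass_Suc) auto
      show ?thesis
        unfolding mass sum_distrib_right by (intro sum.cong refl) (simp only: eq atMost_iff)
    qed
    ultimately show ?thesis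
      by simp
  qed
qed

text \<open>Nonnegative terms make the convergence absolute, so one \<open>sums\<close> fact yields
  both integrability and the value of the integral.\<close>

lemma measure_pmf_nat_integral:
  fixes p :: "nat pmf" and f :: "nat \<Rightarrow> real"
  assumes "\<And>t. 0 \<le> f t" "(\<lambda>t. pmf p t * f t) sums S"
  shows "integrable p f" "integral\<^sup>L p f = S"
proof -
  have int: "integrable (count_space UNIV) (\<lambda>t. pmf p t * f t)"
    using assms by (auto simp: integrable_count_space_nat_iff sums_iff)
  show "integrable p f"
    unfolding measure_pmf_eq_density using int by (subst integrable_density) auto
  have "integral\<^sup>L p f = (\<integral>t. pmf p t * f t \<partial>count_space UNIV)"
    unfolding measure_pmf_eq_density by (subst integral_density) auto
  then show "integral\<^sup>L p f = S"
    using sums_integral_count_space_nat[OF int] assms(2) by (simp add: sums_iff)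
qed

section \<open>Harmonic power sums and the logarithmic series\<close>

text \<open>The difference of harmonic numbers keeps the indices \<open>l = m - j\<close> with
  \<open>j < k\<close>.\<close>

lemma h_harm_power_sum:
  assumes "k \<le> m"
  shows "h_harm n m k \<theta> = (\<Sum>j<k. (real m / (\<theta> * (real m - real j))) ^ n)"
proof -
  have "gen_harm m n - gen_harm (m - k) n = (\<Sum>j<k. 1 / (real m - real j) ^ n)"
    using assms
  proof (induction k)
    case 0
    then show ?case by simp
  next
    case (Suc k)
    have "m - k = Suc (m - Suc k)"
      using Suc.prems by simp
    then have "gen_harm (m - k) n = gen_harm (m - Suc k) n + 1 / real (m - k) ^ n"
      unfolding gen_harm_def by simp
    then show ?case
      using Suc by (simp add: of_nat_diff)
  qed
  then show ?thesis
    by (simp add: h_harm_def sum_distrib_left power_mult_distrib power_divide)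
qed

lemma ln_one_minus_sums:
  fixes y :: real
  assumes "\<bar>y\<bar> < 1"
  shows "(\<lambda>n. y ^ (n + 1) / real (n + 1)) sums (- ln (1 - y))"
proof -
  \<comment> \<open>The term at index 0 is \<open>1 / 0 = 0\<close> by convention, so dropping it
    leaves the sum unchanged.\<close>
  have "(\<lambda>n. y ^ n / real n) sums (- ln (1 - y))"
    using sums_minus[OF ln_series'[of "- y"]] assms by simp
  then show ?thesis
    using sums_Suc_iff[of "\<lambda>n. y ^ n / real n" "- ln (1 - y)"] by simp
qed

theorem theorem4:
  fixes M :: "'a measure" and T :: "'a \<Rightarrow> nat" and m k :: nat and \<theta> :: real
  assumes "0 < k" and "k \<le> m"
    and "0 < \<theta>" and "\<theta> \<le> 1"
    and "prob_space M"
    and "T \<in> measurable M (count_space UNIV)"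
    and "distr M (count_space UNIV) T = measure_pmf (negocc_pmf m k \<theta>)"
  shows "(\<exists>U. open U \<and> 0 \<in> U \<and>
            (\<forall>s\<in>U. integrable M (\<lambda>x. exp (s * real (T x))) \<and>
               summable (\<lambda>n. (1 - exp (- s)) ^ (n + 1) / real (n + 1) * h_harm (n + 1) m k \<theta>) \<and>
               cgf M (\<lambda>x. real (T x)) s =
                 - real k * s +
                 (\<Sum>n. (1 - exp (- s)) ^ (n + 1) / real (n + 1) * h_harm (n + 1) m k \<theta>) \<and>
               (\<forall>r. (deriv ^^ r) (cgf M (\<lambda>x. real (T x))) differentiable (at s)))) \<and>
         (\<forall>r\<ge>1. cumulant M (\<lambda>x. real (T x)) r =
            (\<Sum>i=1..r. (-1) ^ (r - i) * ncStirling r i 0 * fact (i - 1) * h_harm i m k \<theta>)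
            - real k * of_bool (r = 1))"
proof -
  define a where "a j = real m / (\<theta> * (real m - real j))" for j
  \<comment> \<open>On this finite intersection all \<open>k\<close> logarithmic series converge,
    and the same bound keeps the moment generating function finite. At \<open>s = 0\<close> every
    left side is 0.\<close>
  define U where "U = (\<Inter>j\<in>{..<k}. {s. \<bar>a j * (1 - exp (- s))\<bar> < 1})"
  define x where "x j s = a j * exp (- s) / (1 - a j * (1 - exp (- s)))" for j s
  \<comment> \<open>The candidate for the \<open>r\<close>-th derivative of the cumulant generating
    function; the indicator term comes from \<open>- real k * s\<close>.\<close>
  define D where "D r s = (if r = 0 then - real k * s + (\<Sum>j<k. - ln (1 - a j * (1 - exp (- s))))
      else (\<Sum>j<k. stirling_poly r (x j s)) - real k * of_bool (r = 1))" for r s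
  let ?K = "cgf M (\<lambda>x. real (T x))"
  have U: "open U" "0 \<in> U"
    unfolding U_def by (auto intro!: open_INT open_Collect_less continuous_intros)
  have a: "0 < a j" if "j < k" for j
    using that assms(2,3) by (simp add: a_def)
  have pos: "0 < 1 - a j * (1 - exp (- s))" if "s \<in> U" "j < k" for s j
    using that by (force simp: U_def)
  have h: "h_harm n m k \<theta> = (\<Sum>j<k. a j ^ n)" for n
    using h_harm_power_sum[OF assms(2)] by (simp add: a_def)
  have series: "(\<lambda>n. (1 - exp (- s)) ^ (n + 1) / real (n + 1) * h_harm (n + 1) m k \<theta>) sums
      (\<Sum>j<k. - ln (1 - a j * (1 - exp (- s))))" if "s \<in> U" for s
  proof -
    have "(\<lambda>n. \<Sum>j<k. (a j * (1 - exp (- s))) ^ (n + 1) / real (n + 1)) sums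
        (\<Sum>j<k. - ln (1 - a j * (1 - exp (- s))))"
      using that by (intro sums_sum ln_one_minus_sums) (auto simp: U_def)
    then show ?thesis
      unfolding h power_mult_distrib
      by (simp add: sum_distrib_left sum_divide_distrib mult_ac del: power_Suc)
  qed
  have mgf: "integrable M (\<lambda>x. exp (s * real (T x)))" "?K s = D 0 s" if s: "s \<in> U" for s
  proof -
    define q where "q j = \<theta> * (real m - real j) / real m" for j
    have factor: "(1 - q j) * exp s < 1"
        "q j / (1 - (1 - q j) * exp s) = exp (- s) / (1 - a j * (1 - exp (- s)))" if "j < k" for j
    proof -
      have q: "0 < q j" "a j = 1 / q j"
        using that assms(2,3) by (simp_all add: q_def a_def)
      \<comment> \<open>This factorization turns positivity of
        \<open>1 - a j * (1 - exp (- s))\<close> into convergence of the geometric series, and also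
        gives the new form of the factor.\<close>
      have eq: "1 - (1 - q j) * exp s = exp s * q j * (1 - a j * (1 - exp (- s)))"
        unfolding q(2) using q(1) by (simp add: field_simps exp_minus)
      have "0 < 1 - (1 - q j) * exp s"
        unfolding eq using pos[OF s that] q(1) by simp
      then show "(1 - q j) * exp s < 1" by simp
      show "q j / (1 - (1 - q j) * exp s) = exp (- s) / (1 - a j * (1 - exp (- s)))"
        unfolding eq using q(1) by (simp add: exp_minus divide_inverse)
    qed
    have "(\<lambda>t. negocc_mass m k \<theta> t * exp s ^ t) sums (\<Prod>j<k. q j / (1 - (1 - q j) * exp s))"
      using negocc_mass_pgf[OF assms(1-4), of "exp s"] factor(1) by (simp add: q_def)
    then have sums: "(\<lambda>t. pmf (negocc_pmf m k \<theta>) t * exp (s * real t)) sums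
        (\<Prod>j<k. exp (- s) / (1 - a j * (1 - exp (- s))))"
      using assms(1-4) factor(2) by (simp add: pmf_negocc exp_of_nat2_mult)
    note pmf_int = measure_pmf_nat_integral[OF _ sums]
    show "integrable M (\<lambda>x. exp (s * real (T x)))"
      using integrable_distr[OF assms(6), of "\<lambda>t. exp (s * real t)"] pmf_int(1) assms(7) by simp
    have "(\<integral>x. exp (s * real (T x)) \<partial>M) = (\<Prod>j<k. exp (- s) / (1 - a j * (1 - exp (- s))))"
      using integral_distr[OF assms(6), of "\<lambda>t. exp (s * real t)"] pmf_int(2) assms(7) by simp
    then have "?K s = (\<Sum>j<k. ln (exp (- s) / (1 - a j * (1 - exp (- s)))))"
      unfolding cgf_def using pos[OF s] by (simp only:) (rule ln_prod; force)
    also have "\<dots> = (\<Sum>j<k. - s + - ln (1 - a j * (1 - exp (- s))))"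
      using pos[OF s] by (intro sum.cong refl) (force simp: ln_div)
    finally show "?K s = D 0 s"
      unfolding D_def sum.distrib by simp
  qed
  have x: "(x j has_real_derivative (x j s)\<^sup>2 - x j s) (at s)"
      "((\<lambda>s. - ln (1 - a j * (1 - exp (- s)))) has_real_derivative x j s) (at s)"
    if "s \<in> U" "j < k" for s j
  proof -
    note p = pos[OF that]
    show "(x j has_real_derivative (x j s)\<^sup>2 - x j s) (at s)"
      unfolding x_def[abs_def] using p
      by (auto intro!: derivative_eq_intros simp: power2_eq_square divide_simps)
    show "((\<lambda>s. - ln (1 - a j * (1 - exp (- s)))) has_real_derivative x j s) (at s)"
      unfolding x_def using p by (auto intro!: derivative_eq_intros)
  qed
  have D: "(D r has_real_derivative D (Suc r) s) (at s)" if "s \<in> U" for r s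
  proof (cases "r = 0")
    case True
    \<comment> \<open>The constant \<open>- real k\<close> is the indicator term of
      \<open>D 1\<close>, and \<open>stirling_poly_1\<close> identifies the remaining sum.\<close>
    have "((\<lambda>s. - real k * s + (\<Sum>j<k. - ln (1 - a j * (1 - exp (- s))))) has_real_derivative
        - real k + (\<Sum>j<k. x j s)) (at s)"
      using x(2)[OF that] by (intro DERIV_add DERIV_sum DERIV_cmult_Id) auto
    then show ?thesis
      unfolding True by (simp add: D_def[abs_def])
  next
    case False
    have "((\<lambda>s. (\<Sum>j<k. stirling_poly r (x j s)) - real k * of_bool (r = 1)) has_real_derivative
        (\<Sum>j<k. stirling_poly (Suc r) (x j s)) - 0) (at s)"
      using False x(1)[OF that]
      by (intro DERIV_diff DERIV_sum stirling_poly_has_derivative DERIV_const) auto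
    then show ?thesis
      using False by (simp add: D_def[abs_def])
  qed
  note derivs = deriv_funpow_on_open[of U ?K D, OF U(1) mgf(2) D]
  show ?thesis
  proof (intro conjI exI[of _ U] ballI allI impI)
    fix s assume s: "s \<in> U"
    show "integrable M (\<lambda>x. exp (s * real (T x)))"
      using mgf(1) s by blast
    show "summable (\<lambda>n. (1 - exp (- s)) ^ (n + 1) / real (n + 1) * h_harm (n + 1) m k \<theta>)"
      using series[OF s] by (rule sums_summable)
    show "?K s = - real k * s + (\<Sum>n. (1 - exp (- s)) ^ (n + 1) / real (n + 1) * h_harm (n + 1) m k \<theta>)"
      unfolding mgf(2)[OF s] sums_unique[OF series[OF s], symmetric] by (simp add: D_def)
    show "(deriv ^^ r) ?K differentiable (at s)" for r
      using derivs(2)[OF _ _ s] real_differentiable_def by blast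
  next
    fix r :: nat assume r: "1 \<le> r"
    have "cumulant M (\<lambda>x. real (T x)) r = D r 0"
      unfolding cumulant_def using derivs(1)[OF _ _ U(2)] by simp
    also have "\<dots> = (\<Sum>j<k. stirling_poly r (a j)) - real k * of_bool (r = 1)"
      using r by (simp add: D_def x_def)
    also have "(\<Sum>j<k. stirling_poly r (a j)) =
        (\<Sum>i=1..r. (-1) ^ (r - i) * ncStirling r i 0 * fact (i - 1) * h_harm i m k \<theta>)"
      unfolding stirling_poly_def h sum_distrib_left by (rule sum.swap)
    finally show "cumulant M (\<lambda>x. real (T x)) r =
        (\<Sum>i=1..r. (-1) ^ (r - i) * ncStirling r i 0 * fact (i - 1) * h_harm i m k \<theta>)
        - real k * of_bool (r = 1)" .
  qed (use U in auto)
qed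

end
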